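(* There is an absolute constant $C$ such that for every integer $n \ge 1$, $$D(n) \ge \left(\frac12 + \frac1{257}\right) n - C.$$
   Context: Let $P$ be a finite set of points in the plane. A disk (of positive radius) is empty (with respect to $P$) if its interior contains no point of $P$. Disks are called pairwise-disjoint if their interiors are pairwise disjoint (so two disks may touch at a common boundary point). $D(P)$ is the minimum number of disks in a family of pairwise-disjoint empty disks such that each point of $P$ lies on the boundary of at least one disk of the family. $D(n)$ is the maximum of $D(P)$ over all sets $P$ of $n$ points in the plane. *)

theory Defs
  imports "HOL-Analysis.Analysis"
begin

definition is_disk :: "(real^2) set \<Rightarrow> bool" where
  "is_disk B \<longleftrightarrow> (\<exists>c r. r > 0 \<and> B = cball c r)"

definition empty_disk :: "(real^2) set \<Rightarrow> (real^2) set \<Rightarrow> bool" where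
  "empty_disk P B \<longleftrightarrow> is_disk B \<and> interior B \<inter> P = {}"

text \<open>Disjointness refers to interiors, so two disks of a family may be tangent. A family is a
  set rather than a multiset of disks: a repeated disk would have interior meeting its own copy.\<close>

definition pairwise_disjoint_disks :: "(real^2) set set \<Rightarrow> bool" where
  "pairwise_disjoint_disks F \<longleftrightarrow> pairwise (\<lambda>A B. interior A \<inter> interior B = {}) F"

definition covering_family :: "(real^2) set \<Rightarrow> (real^2) set set \<Rightarrow> bool" where
  "covering_family P F \<longleftrightarrow>
     finite F \<and> (\<forall>B\<in>F. empty_disk P B) \<and> pairwise_disjoint_disks F \<and>
     (\<forall>p\<in>P. \<exists>B\<in>F. p \<in> frontier B)"

definition D_set :: "(real^2) set \<Rightarrow> nat" where
  "D_set P = (LEAST k. \<exists>F. covering_family P F \<and> card F = k)"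

definition D :: "nat \<Rightarrow> nat" where
  "D n = Max {D_set P | P. finite P \<and> card P = n}"

text \<open>The minimum and the maximum above are taken over a nonempty, respectively a nonempty and
  finite, set of numbers: small congruent disks, translated copies of one another and each touching
  its own point, always form a covering family.\<close>

lemma covering_family_exists:
  assumes "finite P"
  obtains F where "covering_family P F" "card F \<le> card P"
proof -
  obtain d where d: "d > 0" "\<And>p q. p \<in> P \<Longrightarrow> q \<in> P \<Longrightarrow> p \<noteq> q \<Longrightarrow> d \<le> dist p q"
  proof -
    let ?S = "insert 1 ((\<lambda>(p, q). dist p q) ` {(p, q) \<in> P \<times> P. p \<noteq> q})"
    have fin: "finite ?S"
      using assms by (auto intro: finite_subset[of _ "P \<times> P"])
    have "Min ?S > 0"
      using fin by (subst Min_gr_iff) auto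
    moreover have "Min ?S \<le> dist p q" if "p \<in> P" "q \<in> P" "p \<noteq> q" for p q
      using that fin by (intro Min_le) auto
    ultimately show thesis by (rule that)
  qed
  define r where "r = d / 2"
  have r: "r > 0" using d by (simp add: r_def)
  obtain v :: "real^2" where v: "norm v = r"
    using vector_choose_size[of r] r by auto
  define B where "B p = cball (p + v) r" for p
  have int: "interior (B p) = ball (p + v) r" for p by (simp add: B_def)
  have "interior (B p) \<inter> P = {}" if p: "p \<in> P" for p
  proof (rule ccontr)
    assume "interior (B p) \<inter> P \<noteq> {}"
    then obtain q where q: "q \<in> P" "dist (p + v) q < r" by (auto simp: int)
    have "q \<noteq> p" using q v by (auto simp: dist_norm)
    moreover have "dist p q \<le> dist p (p + v) + dist (p + v) q" by (rule dist_triangle)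
    moreover have "dist p (p + v) = r" using v by (simp add: dist_norm)
    ultimately show False using d(2)[of p q] p q by (simp add: r_def)
  qed
  moreover have "interior (B p) \<inter> interior (B q) = {}" if "p \<in> P" "q \<in> P" "p \<noteq> q" for p q
    using d(2)[of p q] that unfolding int by (intro disjoint_ballI) (simp add: r_def)
  moreover have "p \<in> frontier (B p)" for p
    using v r by (simp add: B_def frontier_cball dist_norm)
  moreover have "is_disk (B p)" for p
    using r by (auto simp: is_disk_def B_def)
  ultimately have "covering_family P (B ` P)"
    using assms unfolding covering_family_def pairwise_disjoint_disks_def pairwise_def
      empty_disk_def by blast
  then show thesis using card_image_le[OF assms] by (rule that)
qed

lemma D_set_attained:
  assumes "finite P"
  shows "\<exists>F. covering_family P F \<and> card F = D_set P"
  unfolding D_set_def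
  by (rule LeastI_ex) (use covering_family_exists[OF assms] in blast)

lemma D_set_le_card:
  assumes "finite P"
  shows "D_set P \<le> card P"
proof -
  obtain F where F: "covering_family P F" "card F \<le> card P"
    using covering_family_exists[OF assms] .
  have "D_set P \<le> card F"
    unfolding D_set_def by (rule Least_le) (use F in blast)
  then show ?thesis using F by simp
qed

lemma D_range_finite: "finite {D_set P | P. finite P \<and> card P = n}"
  by (rule finite_subset[of _ "{..n}"]) (auto simp: D_set_le_card)

lemma D_range_nonempty: "{D_set P | P. finite P \<and> card P = n} \<noteq> {}"
proof -
  have "inj (\<lambda>i. vec (real i) :: real^2)"
    by (auto simp: inj_def vec_eq_iff)
  then have "card ((\<lambda>i. vec (real i) :: real^2) ` {..<n}) = n"
    by (simp add: card_image inj_on_subset)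
  then show ?thesis by blast
qed

end

theory Submission
  imports Defs
begin

text \<open>The points form 51 horizontal rows at distance 124, each filled with points at unit distance,
  and midway between consecutive full rows a sparse row with points at distance 125. Call the disk
  of a point long if it serves points of different rows. A disk serving a sparse point is
  confined to its strip, so no disk serves two sparse points. A disk serving a full row only serves
  at most two, necessarily adjacent, points. A long disk has radius at least 31 and is nearly
  tangent to the full rows that it meets. A disk serving an adjacent pair next to this contact
  has to avoid the long disk, hence is itself so large on the other side of the row that the next
  adjacent pair has no room left. So on each side of the contact some point is served alone, and
  these lonely points make up for the points served by long disks.
  Counting the surplus, essentially every sparse point costs half a disk beyond n/2, and the
  ratio of sparse points to all points is 50 : (51 * 125 + 50) = 2 : 257.\<close>

section \<open>Disks through an adjacent pair\<close>

text \<open>A disk through two adjacent row points has half chord 1/2, so \<open>r\<close> and the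
  signed depth \<open>t\<close> of its centre satisfy the hypothesis. The fixed product turns upper
  bounds on \<open>r - t\<close> into lower bounds on \<open>r + t\<close>.\<close>

lemma pair_product:
  fixes r t :: real
  assumes "r\<^sup>2 = t\<^sup>2 + 1/4"
  shows "(r + t) * (r - t) = 1/4"
proof -
  have "(r + t) * (r - t) = r\<^sup>2 - t\<^sup>2" by (simp add: power2_eq_square algebra_simps)
  then show ?thesis using assms by simp
qed

lemma pair_pos:
  fixes r t :: real
  assumes "r\<^sup>2 = t\<^sup>2 + 1/4" "0 < r"
  shows "0 < r - t" "0 < r + t"
proof -
  have "\<bar>t\<bar> < r" by (rule power2_less_imp_less) (use assms in auto)
  then show "0 < r - t" "0 < r + t" by auto
qed

text \<open>The centres are at horizontal distance \<delta>, and \<open>e\<close> is the offset of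
  the long disk's contact from its centre. Expanding the disjointness condition cancels the squares
  by the two radius equations; then \<rho> is replaced by the smaller \<open>h\<close>.\<close>

lemma pair_below_disk:
  fixes \<delta> h t \<rho> r e :: real
  assumes "\<rho>\<^sup>2 = h\<^sup>2 + e\<^sup>2" "r\<^sup>2 = t\<^sup>2 + 1/4" "0 < r" "0 < h" "0 < \<rho>"
    and "(\<rho> + r)\<^sup>2 \<le> \<delta>\<^sup>2 + (h + t)\<^sup>2"
  shows "2 * h * (r - t) \<le> \<delta>\<^sup>2 - e\<^sup>2 - 1/4"
proof -
  have "h \<le> \<rho>" by (rule power2_le_imp_le) (use assms in auto)
  then have "h * r \<le> \<rho> * r" using assms by simp
  moreover have "2 * \<rho> * r \<le> \<delta>\<^sup>2 - e\<^sup>2 - 1/4 + 2 * h * t"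
    using assms by (simp add: power2_sum)
  ultimately show ?thesis by (simp add: algebra_simps)
qed

text \<open>Here \<open>h\<close> is the height of the long disk's centre above the row, and \<open>t1\<close>, \<open>t2\<close> are the
  depths of the centres of the two pair disks below it. Avoiding the long disk makes \<open>r1 + t1\<close> and
  \<open>r2 + t2\<close> large, whereas disjointness of the pair disks bounds their product.\<close>

lemma consecutive_pairs_clash:
  fixes e h \<rho> r1 r2 t1 t2 :: real
  assumes h: "61/2 \<le> h" and e: "0 \<le> e" "e \<le> 1/2" and \<rho>: "\<rho>\<^sup>2 = h\<^sup>2 + e\<^sup>2" "0 < \<rho>"
    and r1: "r1\<^sup>2 = t1\<^sup>2 + 1/4" "0 < r1" and r2: "r2\<^sup>2 = t2\<^sup>2 + 1/4" "0 < r2"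
    and d1: "(\<rho> + r1)\<^sup>2 \<le> (e + 3/2)\<^sup>2 + (h + t1)\<^sup>2"
    and d2: "(\<rho> + r2)\<^sup>2 \<le> (e + 7/2)\<^sup>2 + (h + t2)\<^sup>2"
    and d12: "(r1 + r2)\<^sup>2 \<le> 2\<^sup>2 + (t1 - t2)\<^sup>2"
  shows False
proof -
  have h0: "0 < h" using h by simp
  note pos = pair_pos[OF r1] pair_pos[OF r2]
  \<comment> \<open>Here \<open>(e + 3/2)^2 - e^2 - 1/4 = 3 * e + 2\<close>; for the second pair the
    value is \<open>7 * e + 12\<close>.\<close>
  have "2 * h * (r1 - t1) \<le> 7/2"
    using pair_below_disk[OF \<rho>(1) r1 h0 \<rho>(2) d1] e by (simp add: power2_eq_square field_simps)
  then have "2 * h * (r1 - t1) * (r1 + t1) \<le> 7/2 * (r1 + t1)"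
    using pos by (intro mult_right_mono) auto
  then have a1: "h \<le> 7 * (r1 + t1)" using pair_product[OF r1(1)] by (simp add: mult.assoc mult.commute[of "r1 - t1"])
  have "2 * h * (r2 - t2) \<le> 31/2"
    using pair_below_disk[OF \<rho>(1) r2 h0 \<rho>(2) d2] e by (simp add: power2_eq_square field_simps)
  then have "2 * h * (r2 - t2) * (r2 + t2) \<le> 31/2 * (r2 + t2)"
    using pos by (intro mult_right_mono) auto
  then have a2: "h \<le> 31 * (r2 + t2)" using pair_product[OF r2(1)] by (simp add: mult.assoc mult.commute[of "r2 - t2"])
  have "61/2 * (61/2) \<le> h * h" using h by (intro mult_mono) auto
  also have "\<dots> \<le> (7 * (r1 + t1)) * (31 * (r2 + t2))" using a1 a2 h0 by (intro mult_mono) auto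
  also have "\<dots> = 217 * ((r1 + t1) * (r2 + t2))" by algebra
  finally have "61/2 * (61/2) \<le> 217 * ((r1 + t1) * (r2 + t2))" .
  \<comment> \<open>The left side equals \<open>2 * (r1 * r2 + t1 * t2)\<close>. The contradiction
    is numerical: 217 * 7/2 = 759.5 is below (61/2)^2 = 930.25.\<close>
  moreover have "(r1 + t1) * (r2 + t2) + (r1 - t1) * (r2 - t2) \<le> 7/2"
    using d12 r1(1) r2(1) by (simp add: power2_sum power2_diff algebra_simps)
  moreover have "0 < (r1 - t1) * (r2 - t2)" using pos by simp
  ultimately show False by simp
qed

text \<open>The long disk above bounds \<open>r - t\<close> by \<open>a^2 / (2 * h)\<close>, the one
  below bounds \<open>r + t\<close> by \<open>b^2 / (2 * h')\<close>. As the product of the two is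
  1/4, multiplying gives \<open>h * h' \<le> (a * b)^2\<close>.\<close>

lemma squeezed_pair:
  fixes a b h h' \<rho> \<rho>' r t e e' :: real
  assumes h: "61/2 \<le> h" "61/2 \<le> h'" and \<rho>: "\<rho>\<^sup>2 = h\<^sup>2 + e\<^sup>2" "0 < \<rho>"
    and \<rho>': "\<rho>'\<^sup>2 = h'\<^sup>2 + e'\<^sup>2" "0 < \<rho>'"
    and r: "r\<^sup>2 = t\<^sup>2 + 1/4" "0 < r"
    and d: "(\<rho> + r)\<^sup>2 \<le> a\<^sup>2 + (h + t)\<^sup>2"
    and d': "(\<rho>' + r)\<^sup>2 \<le> b\<^sup>2 + (h' - t)\<^sup>2"
  shows "61/2 \<le> \<bar>a * b\<bar>"
proof -
  have h0: "0 < h" "0 < h'" using h by auto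
  note pos = pair_pos[OF r]
  have r': "r\<^sup>2 = (- t)\<^sup>2 + 1/4" "0 < r" using r by auto
  have A: "2 * h * (r - t) \<le> a\<^sup>2" using pair_below_disk[OF \<rho>(1) r h0(1) \<rho>(2) d] zero_le_power2[of e] by linarith
  have "2 * h' * (r + t) \<le> b\<^sup>2 - e'\<^sup>2 - 1/4" using pair_below_disk[OF \<rho>'(1) r' h0(2) \<rho>'(2), of b] d' by simp
  then have B: "2 * h' * (r + t) \<le> b\<^sup>2" using zero_le_power2[of e'] by linarith
  have "(2 * h * (r - t)) * (2 * h' * (r + t)) \<le> a\<^sup>2 * b\<^sup>2"
    using A B h0 pos by (intro mult_mono) auto
  then have "h * h' \<le> \<bar>a * b\<bar>\<^sup>2" using pair_product[OF r(1)]
    by (simp add: power_mult_distrib algebra_simps)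
  moreover have "61/2 * (61/2) \<le> h * h'" using h by (intro mult_mono) auto
  ultimately have "(61/2)\<^sup>2 \<le> \<bar>a * b\<bar>\<^sup>2" by (simp add: power2_eq_square)
  then show ?thesis by (rule power2_le_imp_le) simp
qed

section \<open>A single full row\<close>

text \<open>The row is the first coordinate axis; \<open>y\<close> is the signed height of the centre of a disk.\<close>

locale row =
  fixes N :: int and d :: "int \<Rightarrow> 'b" and x y r :: "'b \<Rightarrow> real" and long :: "int set"
  assumes r_pos: "i \<in> {0..N} \<Longrightarrow> 0 < r (d i)"
    and touch: "i \<in> {0..N} \<Longrightarrow> (r (d i))\<^sup>2 = (of_int i - x (d i))\<^sup>2 + (y (d i))\<^sup>2"
    and empty: "i \<in> {0..N} \<Longrightarrow> k \<in> {-1..N+1} \<Longrightarrow> (r (d i))\<^sup>2 \<le> (of_int k - x (d i))\<^sup>2 + (y (d i))\<^sup>2"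
    and disj: "i \<in> {0..N} \<Longrightarrow> k \<in> {0..N} \<Longrightarrow> d i \<noteq> d k \<Longrightarrow>
      (r (d i) + r (d k))\<^sup>2 \<le> (x (d i) - x (d k))\<^sup>2 + (y (d i) - y (d k))\<^sup>2"
    and long_sub: "long \<subseteq> {0..N}"
    and long_radius: "i \<in> long \<Longrightarrow> 31 \<le> r (d i)"
    and long_class: "i \<in> long \<Longrightarrow> k \<in> {0..N} \<Longrightarrow> d k = d i \<Longrightarrow> k \<in> long"
begin

section \<open>Positions and contacts of the disks of a row\<close>

definition single :: "int set" where
  "single = {i \<in> {0..N}. i \<notin> long \<and> (\<forall>k\<in>{0..N}. d k = d i \<longrightarrow> k = i)}"

text \<open>Neither neighbour \<open>i - 1\<close> nor \<open>i + 1\<close> is inside the disk, so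
  the centre is horizontally no farther from \<open>i\<close> than from either of them.\<close>

lemma offset: 
  assumes "i \<in> {0..N}" shows "\<bar>of_int i - x (d i)\<bar> \<le> 1/2"
proof -
  have "(of_int i - x (d i))\<^sup>2 \<le> (of_int (i+1) - x (d i))\<^sup>2" "(of_int i - x (d i))\<^sup>2 \<le> (of_int (i-1) - x (d i))\<^sup>2"
    using empty[of i "i+1"] empty[of i "i-1"] touch[of i] assms by auto
  then have "2 * x (d i) \<le> 1 + of_int i * 2" "of_int i * 2 \<le> 1 + 2 * x (d i)"
    by (simp_all add: power2_eq_square algebra_simps)
  then show ?thesis by linarith
qed

lemma long_height:
  assumes "i \<in> long" shows "61/2 \<le> \<bar>y (d i)\<bar>"
proof -
  have iN: "i \<in> {0..N}" using assms long_sub by auto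
  have "31\<^sup>2 \<le> (r (d i))\<^sup>2" using long_radius[OF assms] by (intro power_mono) auto
  moreover have "(of_int i - x (d i))\<^sup>2 \<le> (1/2)\<^sup>2"
    using offset[OF iN] by (simp only: power2_le_iff_abs_le)
  ultimately have "(61/2)\<^sup>2 \<le> \<bar>y (d i)\<bar>\<^sup>2" using touch[OF iN] by (simp add: power_divide)
  then show ?thesis by (rule power2_le_imp_le) simp
qed

text \<open>Both points are within 1/2 of the same centre, so they are at distance 1 and the centre
  is above or below their midpoint.\<close>

lemma class_adjacent:
  assumes "i \<in> {0..N}" "k \<in> {0..N}" "d i = d k" "i \<noteq> k"
  shows "k = i + 1 \<and> x (d i) = of_int i + 1/2 \<or> k = i - 1 \<and> x (d i) = of_int i - 1/2"
proof -
  have "\<bar>real_of_int i - of_int k\<bar> \<le> 1" using offset[OF assms(1)] offset[OF assms(2)] unfolding assms(3) by linarith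
  then have "\<bar>i - k\<bar> \<le> 1" by linarith
  then have "k = i + 1 \<or> k = i - 1" using assms by auto
  then have "k = i + 1 \<and> of_int k = (of_int i + 1 :: real) \<or> k = i - 1 \<and> of_int k = (of_int i - 1 :: real)"
    by auto
  then show ?thesis using offset[OF assms(1)] offset[OF assms(2), folded assms(3)] by linarith
qed

lemma pair_radius:
  assumes "i \<in> {0..N}" "k \<in> {0..N}" "d i = d k" "i \<noteq> k"
  shows "(r (d i))\<^sup>2 = (y (d i))\<^sup>2 + 1/4"
  using touch[OF assms(1)] class_adjacent[OF assms] by (auto simp: power2_eq_square)

section \<open>Long disks on the same side and on opposite sides\<close>

text \<open>Radii are at least the heights, so disjointness gives
  \<open>4 * y * y' \<le> (x - x')^2\<close> when the heights have equal sign; each height is at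
  least 61/2 in absolute value.\<close>

lemma same_side_separated:
  assumes "i \<in> long" "k \<in> long" "d i \<noteq> d k" "0 < y (d i) * y (d k)"
  shows "61 \<le> \<bar>x (d i) - x (d k)\<bar>"
proof -
  have ik: "i \<in> {0..N}" "k \<in> {0..N}" using assms long_sub by auto
  have r1: "\<bar>y (d j)\<bar> \<le> r (d j)" if "j \<in> {0..N}" for j
    by (rule power2_le_imp_le) (use touch[OF that] r_pos[OF that] in auto)
  have "(\<bar>y (d i)\<bar> + \<bar>y (d k)\<bar>)\<^sup>2 \<le> (r (d i) + r (d k))\<^sup>2"
    using r1[OF ik(1)] r1[OF ik(2)] by (intro power_mono) auto
  also have "\<dots> \<le> (x (d i) - x (d k))\<^sup>2 + (y (d i) - y (d k))\<^sup>2" using disj ik assms by auto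
  finally have "4 * \<bar>y (d i) * y (d k)\<bar> \<le> (x (d i) - x (d k))\<^sup>2"
    using assms(4) by (simp add: power2_sum power2_diff abs_mult[symmetric] algebra_simps)
  moreover have "61/2 * (61/2) \<le> \<bar>y (d i)\<bar> * \<bar>y (d k)\<bar>"
    using assms long_height by (intro mult_mono) auto
  ultimately have "61\<^sup>2 \<le> \<bar>x (d i) - x (d k)\<bar>\<^sup>2" by (simp add: abs_mult)
  then show ?thesis by (rule power2_le_imp_le) simp
qed

lemma same_side_close:
  assumes "i \<in> long" "k \<in> long" "0 < y (d i) * y (d k)" "\<bar>x (d i) - x (d k)\<bar> < 61"
  shows "d i = d k"
  using same_side_separated assms by force

lemma y_nonzero: "i \<in> long \<Longrightarrow> y (d i) \<noteq> 0"
  using long_height[of i] by auto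

lemma class_eq_of_opposite:
  assumes "i \<in> long" "k \<in> long" "j \<in> long" "y (d i) * y (d k) < 0"
    "\<bar>x (d i) - x (d j)\<bar> < 61" "\<bar>x (d k) - x (d j)\<bar> < 61"
  shows "d j = d i \<or> d j = d k"
proof -
  have "0 < y (d i) * y (d j) \<or> 0 < y (d k) * y (d j)"
    using y_nonzero[OF assms(3)] assms(4) by (auto simp: zero_less_mult_iff mult_less_0_iff)
  then show ?thesis using same_side_close[of i j] same_side_close[of k j] assms by metis
qed

lemma no_pair_between:
  assumes i: "i \<in> long" and k: "k \<in> long" and opp: "y (d i) * y (d k) < 0"
    and j: "j \<in> {0..N}" "l \<in> {0..N}" "j \<noteq> l" "d j = d l" "j \<notin> long"
  shows "61/2 \<le> \<bar>(x (d j) - x (d i)) * (x (d j) - x (d k))\<bar>"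
proof -
  have ik: "i \<in> {0..N}" "k \<in> {0..N}" using i k long_sub by auto
  have ne: "d i \<noteq> d j" "d k \<noteq> d j" using long_class i k j by metis+
  \<comment> \<open>Reflecting by the sign \<sigma> puts the disk of \<open>i\<close> above the row
    and that of \<open>k\<close> below; \<open>- \<sigma> * y (d j)\<close> is then the depth of the
    pair's centre.\<close>
  define \<sigma> where "\<sigma> = sgn (y (d i))"
  have yi: "y (d i) = \<sigma> * \<bar>y (d i)\<bar>" and yk: "y (d k) = - \<sigma> * \<bar>y (d k)\<bar>" and s: "\<sigma>\<^sup>2 = 1"
    using opp unfolding \<sigma>_def by (auto simp: sgn_if mult_less_0_iff power2_eq_square)
  have ss: "\<sigma> * (\<sigma> * w) = w" for w using s by (metis mult.assoc mult_1 power2_eq_square)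
  have sq: "(w)\<^sup>2 = (\<sigma> * w)\<^sup>2" for w using s by (simp add: power_mult_distrib)
  have 1: "(y (d i) - y (d j))\<^sup>2 = (\<bar>y (d i)\<bar> + - \<sigma> * y (d j))\<^sup>2"
    by (subst sq, subst yi) (simp add: right_diff_distrib ss)
  have 2: "(y (d k) - y (d j))\<^sup>2 = (\<bar>y (d k)\<bar> - - \<sigma> * y (d j))\<^sup>2"
    by (subst sq, subst yk, subst power2_minus[symmetric]) (simp add: right_diff_distrib ss)
  have rj: "(r (d j))\<^sup>2 = (- \<sigma> * y (d j))\<^sup>2 + 1/4"
    using pair_radius[OF j(1,2,4,3)] s by (simp add: power_mult_distrib)
  show ?thesis
  proof (rule squeezed_pair[OF long_height[OF i] long_height[OF k] _ r_pos[OF ik(1)] _ r_pos[OF ik(2)] rj r_pos[OF j(1)]])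
    show "(r (d i))\<^sup>2 = \<bar>y (d i)\<bar>\<^sup>2 + (of_int i - x (d i))\<^sup>2" "(r (d k))\<^sup>2 = \<bar>y (d k)\<bar>\<^sup>2 + (of_int k - x (d k))\<^sup>2"
      using touch ik by auto
    show "(r (d i) + r (d j))\<^sup>2 \<le> (x (d j) - x (d i))\<^sup>2 + (\<bar>y (d i)\<bar> + - \<sigma> * y (d j))\<^sup>2"
      using disj[OF ik(1) j(1) ne(1)] unfolding 1 by (simp add: power2_commute)
    show "(r (d k) + r (d j))\<^sup>2 \<le> (x (d j) - x (d k))\<^sup>2 + (\<bar>y (d k)\<bar> - - \<sigma> * y (d j))\<^sup>2"
      using disj[OF ik(2) j(1) ne(2)] unfolding 2 by (simp add: power2_commute)
  qed
qed

text \<open>If none of the next four points in direction \<open>s\<close> were lonely, they would be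
  served as two consecutive adjacent pairs, which \<open>consecutive_pairs_clash\<close> excludes.
  The hypothesis \<open>side\<close> says that the contact is displaced from the centre towards
  \<open>s\<close>, if at all.\<close>

lemma single_beside:
  assumes i: "i \<in> long" and s: "s = 1 \<or> s = -1" and side: "0 \<le> of_int s * (of_int i - x (d i))"
    and new: "d (i + s) \<noteq> d i" and range: "4 \<le> i" "i + 4 \<le> N"
    and far: "\<And>k. k \<in> long \<Longrightarrow> \<bar>x (d k) - x (d i)\<bar> \<le> 11 \<Longrightarrow> d k = d i"
  shows "\<exists>m\<in>{1..4}. i + s * m \<in> single"
proof (rule ccontr)
  assume neg: "\<not> ?thesis"
  have in_range: "i + s * m \<in> {0..N}" if "m \<in> {0..4}" for m using range s that by auto
  have iN: "i \<in> {0..N}" using in_range[of 0] by simp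
  have other: "d (i + s * m) \<noteq> d i" if "m \<in> {1..4}" for m
  proof
    assume "d (i + s * m) = d i"
    then have "i + s * m = i + 1 \<or> i + s * m = i - 1"
      using class_adjacent[OF iN in_range[of m]] that s by auto
    then have "m = 1" using that s by auto
    then show False using new \<open>d (i + s * m) = d i\<close> by simp
  qed
  have short: "i + s * m \<notin> long" if m: "m \<in> {1..4}" for m
  proof
    assume l: "i + s * m \<in> long"
    have "\<bar>of_int (i + s * m) - of_int i\<bar> \<le> (4::real)" using m s by auto
    then have "\<bar>x (d (i + s * m)) - x (d i)\<bar> \<le> 11"
      using offset[OF in_range[of m]] offset[OF iN] m unfolding abs_le_iff by auto
    then show False using far[OF l] other[OF m] by simp
  qed
  have partner: "\<exists>k\<in>{0..N}. d k = d (i + s * m) \<and> (k = i + s * (m + 1) \<or> k = i + s * (m - 1))" if m: "m \<in> {1..4}" for m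
  proof -
    have "i + s * m \<notin> single" using neg m by blast
    then obtain k where k: "k \<in> {0..N}" "d k = d (i + s * m)" "k \<noteq> i + s * m"
      using short[OF m] in_range[of m] m unfolding single_def by auto
    then have "k = i + s * m + 1 \<or> k = i + s * m - 1"
      using class_adjacent[OF in_range[of m] k(1)] m by auto
    then show ?thesis using k s by (intro bexI[of _ k]) (auto simp: algebra_simps)
  qed
  have e12: "d (i + s * 2) = d (i + s * 1)"
    using partner[of 1] other[of 1] by auto
  have e34: "d (i + s * 4) = d (i + s * 3)"
  proof -
    have "d (i + s * 2) \<noteq> d (i + s * 3)"
    proof
      assume "d (i + s * 2) = d (i + s * 3)"
      then show False using e12 class_adjacent[OF in_range[of 1] in_range[of 3]] s by auto
    qed
    then show ?thesis using partner[of 3] by auto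
  qed
  have sr: "real_of_int s = 1 \<or> real_of_int s = -1" using s by auto
  have x1: "x (d (i + s * 1)) = of_int i + of_int s * (3/2)"
    using class_adjacent[OF in_range[of 1] in_range[of 2]] e12 s by auto
  have x3: "x (d (i + s * 3)) = of_int i + of_int s * (7/2)"
    using class_adjacent[OF in_range[of 3] in_range[of 4]] e34 s by auto
  have n13: "d (i + s * 1) \<noteq> d (i + s * 3)" using x1 x3 s by auto
  define \<sigma> where "\<sigma> = sgn (y (d i))"
  have yi: "y (d i) = \<sigma> * \<bar>y (d i)\<bar>" and ss1: "\<sigma>\<^sup>2 = 1"
    using y_nonzero[OF i] unfolding \<sigma>_def by (auto simp: sgn_if power2_eq_square)
  have ss: "\<sigma> * (\<sigma> * w) = w" for w using ss1 by (metis mult.assoc mult_1 power2_eq_square)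
  have sq: "(w)\<^sup>2 = (\<sigma> * w)\<^sup>2" for w using ss1 by (simp add: power_mult_distrib)
  have 1: "(y (d i) - w)\<^sup>2 = (\<bar>y (d i)\<bar> + - \<sigma> * w)\<^sup>2" for w
    by (subst sq, subst yi) (simp add: right_diff_distrib ss)
  \<comment> \<open>With this nonnegative offset, the pair centres lie at horizontal distances
    \<open>e + 3/2\<close> and \<open>e + 7/2\<close> from the long disk's centre.\<close>
  define e where "e = of_int s * (of_int i - x (d i))"
  have e: "0 \<le> e" "e \<le> 1/2" using side offset[OF iN] s unfolding e_def by auto
  have rp: "(r (d (i + s * 1)))\<^sup>2 = (- \<sigma> * y (d (i + s * 1)))\<^sup>2 + 1/4"
    "(r (d (i + s * 3)))\<^sup>2 = (- \<sigma> * y (d (i + s * 3)))\<^sup>2 + 1/4"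
    using pair_radius[OF in_range[of 1] in_range[of 2]] pair_radius[OF in_range[of 3] in_range[of 4]]
      e12 e34 ss1 s by (auto simp: power_mult_distrib)
  show False
  proof (rule consecutive_pairs_clash[OF long_height[OF i] e _ r_pos[OF iN] rp(1) r_pos[OF in_range[of 1]] rp(2) r_pos[OF in_range[of 3]]])
    show "(r (d i))\<^sup>2 = \<bar>y (d i)\<bar>\<^sup>2 + e\<^sup>2"
      using touch[OF iN] sr unfolding e_def by (auto simp: power2_commute)
    have "(x (d i) - x (d (i + s * 1)))\<^sup>2 = (e + 3/2)\<^sup>2"
      using sr unfolding x1 e_def by (auto simp: power2_eq_square algebra_simps)
    then show "(r (d i) + r (d (i + s * 1)))\<^sup>2 \<le> (e + 3/2)\<^sup>2 + (\<bar>y (d i)\<bar> + - \<sigma> * y (d (i + s * 1)))\<^sup>2"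
      using disj[OF iN in_range[of 1]] other[of 1] 1[of "y (d (i + s * 1))"] by auto
    have "(x (d i) - x (d (i + s * 3)))\<^sup>2 = (e + 7/2)\<^sup>2"
      using sr unfolding x3 e_def by (auto simp: power2_eq_square algebra_simps)
    then show "(r (d i) + r (d (i + s * 3)))\<^sup>2 \<le> (e + 7/2)\<^sup>2 + (\<bar>y (d i)\<bar> + - \<sigma> * y (d (i + s * 3)))\<^sup>2"
      using disj[OF iN in_range[of 3]] other[of 3] 1[of "y (d (i + s * 3))"] by auto
    have "(x (d (i + s * 1)) - x (d (i + s * 3)))\<^sup>2 = 2\<^sup>2"
      using sr unfolding x1 x3 by (auto simp: power2_eq_square algebra_simps)
    moreover have "(y (d (i + s * 1)) - y (d (i + s * 3)))\<^sup>2 = (- \<sigma> * y (d (i + s * 1)) - - \<sigma> * y (d (i + s * 3)))\<^sup>2"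
      by (subst sq, subst power2_minus[symmetric]) (simp add: right_diff_distrib)
    ultimately show "(r (d (i + s * 1)) + r (d (i + s * 3)))\<^sup>2 \<le> 2\<^sup>2 + (- \<sigma> * y (d (i + s * 1)) - - \<sigma> * y (d (i + s * 3)))\<^sup>2"
      using disj[OF in_range[of 1] in_range[of 3] n13] by simp
  qed auto
qed

lemma finite_class: "finite {j\<in>{0..N}. d j = v}"
  by (rule finite_subset[of _ "{0..N}"]) auto

lemma class_card: "card {j\<in>{0..N}. d j = v} \<le> 2"
proof -
  have "\<exists>a. {j\<in>{0..N}. d j = v} \<subseteq> {a, a + 1}"
  proof (cases "\<exists>j\<in>{0..N}. d j = v \<and> (j - 1 \<in> {0..N} \<and> d (j - 1) = v)")
    case True
    then obtain j where j: "j \<in> {0..N}" "d j = v" "j - 1 \<in> {0..N}" "d (j - 1) = v" by auto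
    have "k = j - 1 \<or> k = j" if "k \<in> {0..N}" "d k = v" for k
      using class_adjacent[OF j(1) that(1)] class_adjacent[OF j(3) that(1)] j that by auto
    then show ?thesis by (intro exI[of _ "j - 1"]) auto
  next
    case False
    show ?thesis
    proof (cases "\<exists>j\<in>{0..N}. d j = v")
      case True
      then obtain j where j: "j \<in> {0..N}" "d j = v" by auto
      have "k = j \<or> k = j + 1" if "k \<in> {0..N}" "d k = v" for k
        using class_adjacent[OF j(1) that(1)] j that False by metis
      then show ?thesis by (intro exI[of _ j]) auto
    next
      case False
      then have "{j\<in>{0..N}. d j = v} = {}" by auto
      then show ?thesis by (metis empty_subsetI)
    qed
  qed
  then obtain a where "{j\<in>{0..N}. d j = v} \<subseteq> {a, a + 1}" ..
  then have "card {j\<in>{0..N}. d j = v} \<le> card {a, a + 1}" by (intro card_mono) auto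
  then show ?thesis by simp
qed

section \<open>Clusters of long contacts and their lonely points\<close>

text \<open>Long disks on the same side of the row are far apart, so a cluster consists of the contacts of
  one long disk, or of two long disks on opposite sides of the row.\<close>

definition cluster :: "int \<Rightarrow> int set" where
  "cluster i = {k \<in> long. \<bar>x (d k) - x (d i)\<bar> \<le> 11}"

text \<open>The radius is half of the 11 used for clusters, so that a point in two zones brings two
  long centres within 11 and makes their clusters equal.\<close>

definition zone :: "int set \<Rightarrow> int set" where
  "zone K = {s \<in> single. \<exists>k\<in>K. \<bar>of_int s - x (d k)\<bar> \<le> 11/2}"

lemma finite_long: "finite long"
  by (rule finite_subset[OF long_sub]) simp

lemma finite_single: "finite single"
  by (rule finite_subset[of _ "{0..N}"]) (auto simp: single_def)

lemma finite_zone: "finite (zone K)"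
  using finite_single unfolding zone_def by auto

lemma opposite_or_same:
  assumes "i \<in> long" "k \<in> long" "\<bar>x (d k) - x (d i)\<bar> < 61" "d k \<noteq> d i"
  shows "y (d i) * y (d k) < 0"
  using same_side_close[of i k] assms y_nonzero[of i] y_nonzero[of k]
  by (metis abs_minus_commute linorder_neqE_linordered_idom mult_eq_0_iff)

text \<open>If the outer two disks differ, they are within 22 < 61 and hence on opposite sides; the
  middle disk must then be one of them, and one of the two hypotheses is already the claim. Thus
  clusters partition \<open>long\<close>.\<close>

lemma close_trans:
  assumes "i \<in> long" "k \<in> long" "l \<in> long"
    and "\<bar>x (d k) - x (d i)\<bar> \<le> 11" "\<bar>x (d l) - x (d k)\<bar> \<le> 11"
  shows "\<bar>x (d l) - x (d i)\<bar> \<le> 11"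
proof (cases "d l = d i")
  case False
  then have "y (d i) * y (d l) < 0" using assms by (intro opposite_or_same) auto
  then have "d k = d i \<or> d k = d l" using class_eq_of_opposite[of i l k] assms by auto
  then show ?thesis using assms by auto
qed simp

lemma cluster_eq:
  assumes "i \<in> long" "k \<in> long" "\<bar>x (d k) - x (d i)\<bar> \<le> 11"
  shows "cluster k = cluster i"
proof -
  have "\<bar>x (d i) - x (d k)\<bar> \<le> 11" using assms by (simp add: abs_minus_commute)
  then show ?thesis
    using close_trans[OF assms(1,2) _ assms(3)] close_trans[OF assms(2,1)] unfolding cluster_def by blast
qed

text \<open>Squeezed between two long disks, no adjacent pair near the midpoint of their centres can be
  served: ten consecutive points, of which at most four are served by the long disks.\<close>

lemma mixed_cluster_singles:
  assumes i: "i \<in> long" and range: "20 \<le> i" "i + 20 \<le> N"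
    and k: "k \<in> cluster i" "d k \<noteq> d i"
  shows "card (cluster i) \<le> card (zone (cluster i))"
proof -
  let ?C = "\<lambda>v. {j\<in>{0..N}. d j = v}"
  have kl: "k \<in> long" and near: "\<bar>x (d k) - x (d i)\<bar> \<le> 11" using k unfolding cluster_def by auto
  have iN: "i \<in> {0..N}" using i long_sub by auto
  have opp: "y (d i) * y (d k) < 0" using opposite_or_same[OF i kl] near k by auto
  have i_self: "i \<in> cluster i" using i unfolding cluster_def by auto
  have two: "d j = d i \<or> d j = d k" if "j \<in> long" "\<bar>x (d j) - x (d i)\<bar> < 50" for j
    using that near by (intro class_eq_of_opposite[OF i kl _ opp]) auto
  \<comment> \<open>Midpoint and half distance of the two long centres; \<open>W\<close> consists of
    the ten integers nearest to the midpoint, up to ties.\<close>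
  define \<mu> where "\<mu> = (x (d i) + x (d k)) / 2"
  define D where "D = (x (d k) - x (d i)) / 2"
  have xi: "x (d i) = \<mu> - D" and xk: "x (d k) = \<mu> + D" and D: "\<bar>D\<bar> \<le> 11/2"
    using near by (auto simp: \<mu>_def D_def field_simps)
  define W where "W = {\<lfloor>\<mu>\<rfloor> - 4..\<lfloor>\<mu>\<rfloor> + 5}"
  have W: "\<bar>of_int j - \<mu>\<bar> \<le> 5" if "j \<in> W" for j
  proof -
    have "\<lfloor>\<mu>\<rfloor> - 4 \<le> j" "j \<le> \<lfloor>\<mu>\<rfloor> + 5" using that unfolding W_def by auto
    then show ?thesis by linarith
  qed
  have WN: "j \<in> {1..N-1}" if "j \<in> W" for j
  proof -
    have "\<bar>of_int j - of_int i\<bar> \<le> (12::real)" using W[OF that] offset[OF iN] D unfolding xi by linarith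
    then show ?thesis using range by auto
  qed
  have "j \<in> zone (cluster i)" if j: "j \<in> W - (?C (d i) \<union> ?C (d k))" for j
  proof -
    have jN: "j \<in> {0..N}" using WN[of j] j by auto
    have nl: "j \<notin> long"
    proof
      assume l: "j \<in> long"
      have "\<bar>of_int j - \<mu>\<bar> \<le> 5" using W j by auto
      then have "\<bar>x (d j) - x (d i)\<bar> < 50" using offset[OF jN] D unfolding xi by linarith
      then show False using two[OF l] j jN by auto
    qed
    have "k' = j" if k': "k' \<in> {0..N}" "d k' = d j" for k'
    proof (rule ccontr)
      assume ne: "k' \<noteq> j"
      have b: "61/2 \<le> \<bar>(x (d j) - x (d i)) * (x (d j) - x (d k))\<bar>"
        using no_pair_between[OF i kl opp jN k'(1)] ne k' nl by auto
      define c where "c = x (d j) - \<mu>"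
      have "\<bar>of_int j - \<mu>\<bar> \<le> 5" using W j by auto
      then have c: "\<bar>c\<bar> \<le> 11/2" using offset[OF jN] unfolding c_def by linarith
      \<comment> \<open>A difference of squares, each at most 121/4 = 30.25: just below the 61/2 =
        30.5 demanded by \<open>no_pair_between\<close>.\<close>
      have "(x (d j) - x (d i)) * (x (d j) - x (d k)) = c\<^sup>2 - D\<^sup>2"
        unfolding xi xk c_def by (simp add: power2_eq_square algebra_simps)
      moreover have "c\<^sup>2 \<le> 121/4" "D\<^sup>2 \<le> 121/4"
        using c D power2_le_iff_abs_le[of "11/2" c] power2_le_iff_abs_le[of "11/2" D]
        by (simp_all add: power_divide)
      ultimately have "\<bar>(x (d j) - x (d i)) * (x (d j) - x (d k))\<bar> \<le> 121/4"
        using zero_le_power2[of c] zero_le_power2[of D] by linarith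
      then show False using b by simp
    qed
    then have "j \<in> single" using jN nl unfolding single_def by auto
    moreover have "\<bar>of_int j - \<mu>\<bar> \<le> 5" using W j by auto
    \<comment> \<open>The centres are at \<open>\<mu> - D\<close> and \<open>\<mu> + D\<close>, so
      the nearer one is at distance \<open>\<bar>\<bar>j - \<mu>\<bar> - \<bar>D\<bar>\<bar>\<close>
      from \<open>j\<close>.\<close>
    then have "\<bar>of_int j - x (d i)\<bar> \<le> 11/2 \<or> \<bar>of_int j - x (d k)\<bar> \<le> 11/2"
      using D unfolding xi xk by linarith
    ultimately show ?thesis using i_self k unfolding zone_def by blast
  qed
  then have "card (W - (?C (d i) \<union> ?C (d k))) \<le> card (zone (cluster i))"
    using finite_zone by (intro card_mono) auto
  moreover have "card W - card (?C (d i) \<union> ?C (d k)) \<le> card (W - (?C (d i) \<union> ?C (d k)))"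
    by (rule diff_card_le_card_Diff) (intro finite_UnI finite_class)
  moreover have "card W = 10" unfolding W_def by simp
  moreover have c4: "card (?C (d i) \<union> ?C (d k)) \<le> 4"
    using card_Un_le[of "?C (d i)" "?C (d k)"] class_card[of "d i"] class_card[of "d k"] by linarith
  moreover have "card (cluster i) \<le> card (?C (d i) \<union> ?C (d k))"
    using two long_sub unfolding cluster_def
    by (intro card_mono finite_UnI finite_class) force
  ultimately show ?thesis by linarith
qed

text \<open>A long disk with two contacts in the row has its centre midway, so
  \<open>single_beside\<close> applies on both sides and yields two lonely points. With one contact,
  the side to which the contact is displaced yields one.\<close>

lemma lone_cluster_singles:
  assumes i: "i \<in> long" and range: "20 \<le> i" "i + 20 \<le> N"
    and far: "\<And>k. k \<in> cluster i \<Longrightarrow> d k = d i"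
  shows "card (cluster i) \<le> card (zone (cluster i))"
proof -
  have far': "d k = d i" if "k \<in> long" "\<bar>x (d k) - x (d i)\<bar> \<le> 11" for k
    using far that unfolding cluster_def by auto
  have iN: "i \<in> {0..N}" using i long_sub by auto
  have i_self: "i \<in> cluster i" using i unfolding cluster_def by auto
  have sub: "cluster i \<subseteq> {j\<in>{0..N}. d j = d i}" using far long_sub unfolding cluster_def by auto
  have zoneI: "j \<in> zone (cluster i)" if "j \<in> single" "\<bar>of_int j - x (d i)\<bar> \<le> 11/2" for j
    using that i_self unfolding zone_def by auto
  have beside: "\<exists>m\<in>{1..4}. a + s * m \<in> zone (cluster i)"
    if a: "a \<in> {0..N}" "d a = d i" and s: "s = 1 \<or> s = -1" and side: "0 \<le> of_int s * (of_int a - x (d i))"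
      and new: "d (a + s) \<noteq> d i" for a s
  proof -
    have "a = i \<or> a = i - 1 \<or> a = i + 1" using class_adjacent[OF iN a(1)] a by auto
    then have ra: "4 \<le> a" "a + 4 \<le> N" using range by auto
    have al: "a \<in> long" using long_class[OF i a] .
    obtain m where m: "m \<in> {1..4}" "a + s * m \<in> single"
      using single_beside[OF al s _ _ ra] side new far' a(2) by auto
    have "\<bar>of_int (a + s * m) - of_int a\<bar> \<le> (4::real)" using m s by auto
    then have "\<bar>of_int (a + s * m) - x (d i)\<bar> \<le> 11/2" using offset[OF a(1)] unfolding a(2) by linarith
    then show ?thesis using m zoneI by blast
  qed
  have pair: "card (cluster i) \<le> card (zone (cluster i))"
    if a: "a \<in> {0..N}" "a + 1 \<in> {0..N}" "d a = d i" "d (a + 1) = d i" for a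
  proof -
    have xa: "x (d i) = of_int a + 1/2" using class_adjacent[OF a(1,2)] a by auto
    have "d (a + 1 + 1) \<noteq> d i" "d (a - 1) \<noteq> d i"
    proof -
      have "a = i \<or> a + 1 = i" using class_adjacent[OF iN a(1)] class_adjacent[OF iN a(2)] a by force
      then have "19 \<le> a" "a + 20 \<le> N" using range by auto
      then have "a + 1 + 1 \<in> {0..N}" "a - 1 \<in> {0..N}" by auto
      then show "d (a + 1 + 1) \<noteq> d i" "d (a - 1) \<noteq> d i"
        using class_adjacent[OF a(1), of "a + 1 + 1"] class_adjacent[OF a(2), of "a - 1"] a by auto
    qed
    then obtain m m' where m: "m \<in> {1..4}" "a + 1 + 1 * m \<in> zone (cluster i)"
      and m': "m' \<in> {1..4}" "a + (-1) * m' \<in> zone (cluster i)"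
      using beside[OF a(2,4), of 1] beside[OF a(1,3), of "-1"] xa by auto
    have "card {a + 1 + 1 * m, a + (-1) * m'} \<le> card (zone (cluster i))"
      using m m' finite_zone by (intro card_mono) auto
    moreover have "a + 1 + 1 * m \<noteq> a + (-1) * m'" using m m' by auto
    ultimately show ?thesis
      using card_mono[OF finite_class sub] class_card[of "d i"] by simp
  qed
  show ?thesis
  proof (cases "d (i + 1) = d i \<or> d (i - 1) = d i")
    case True
    then show ?thesis using pair[of i] pair[of "i - 1"] range by auto
  next
    case False
    then have "cluster i \<subseteq> {i}" using sub class_adjacent[OF iN] by fastforce
    then have "card (cluster i) \<le> card {i}" by (intro card_mono) auto
    moreover have "\<exists>j. j \<in> zone (cluster i)"
    proof (cases "x (d i) \<le> of_int i")
      case True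
      then show ?thesis using beside[OF iN refl, of 1] False by auto
    next
      case False2: False
      then show ?thesis using beside[OF iN refl, of "-1"] False by auto
    qed
    then have "0 < card (zone (cluster i))" using finite_zone by (auto simp: card_gt_0_iff)
    ultimately show ?thesis by simp
  qed
qed

text \<open>Every cluster has at least as many lonely points in its zone as members, and zones of
  different clusters are disjoint. The 40 accounts for the twenty positions at each end, where the
  cluster estimates lack room.\<close>

theorem long_le_single: "card long \<le> card single + 40"
proof -
  define inner where "inner = {i \<in> long. 20 \<le> i \<and> i + 20 \<le> N}"
  define K where "K = cluster ` inner"
  have fin: "finite inner" "finite K" unfolding inner_def K_def using finite_long by auto
  have finc: "finite (cluster i)" for i using finite_long unfolding cluster_def by auto
  have "inner \<subseteq> \<Union>K" unfolding K_def inner_def cluster_def by auto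
  then have "card inner \<le> card (\<Union>K)" using fin finc unfolding K_def by (intro card_mono) auto
  also have "\<dots> \<le> (\<Sum>c\<in>K. card c)" by (rule card_Union_le_sum_card)
  also have "\<dots> \<le> (\<Sum>c\<in>K. card (zone c))"
  proof (rule sum_mono)
    fix c assume "c \<in> K"
    then obtain i where "c = cluster i" "i \<in> long" "20 \<le> i" "i + 20 \<le> N" unfolding K_def inner_def by auto
    then show "card c \<le> card (zone c)"
      using lone_cluster_singles[of i] mixed_cluster_singles[of i] by blast
  qed
  also have "\<dots> = card (\<Union>c\<in>K. zone c)"
  proof (rule card_UN_disjoint[symmetric])
    show "\<forall>c\<in>K. \<forall>c'\<in>K. c \<noteq> c' \<longrightarrow> zone c \<inter> zone c' = {}"
    proof (intro ballI impI, rule ccontr)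
      fix c c' assume c: "c \<in> K" "c' \<in> K" "c \<noteq> c'" and "zone c \<inter> zone c' \<noteq> {}"
      then obtain s k k' where s: "k \<in> c" "k' \<in> c'" "\<bar>of_int s - x (d k)\<bar> \<le> 11/2" "\<bar>of_int s - x (d k')\<bar> \<le> 11/2"
        unfolding zone_def by auto
      obtain i i' where i: "c = cluster i" "c' = cluster i'" "i \<in> long" "i' \<in> long"
        using c unfolding K_def inner_def by auto
      have kl: "k \<in> long" "k' \<in> long" using s i unfolding cluster_def by auto
      have "c = cluster k" "c' = cluster k'"
        using s i kl cluster_eq[of i k] cluster_eq[of i' k'] unfolding cluster_def by auto
      moreover have "\<bar>x (d k') - x (d k)\<bar> \<le> 11" using s(3,4) by linarith
      ultimately show False using cluster_eq[OF kl] c by simp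
    qed
  qed (use fin finite_zone in auto)
  also have "\<dots> \<le> card single" using finite_single unfolding zone_def by (intro card_mono) auto
  finally have "card inner \<le> card single" .
  moreover have "card long \<le> card inner + card ({0..19} \<union> {N-19..N})"
  proof -
    have "long \<subseteq> inner \<union> ({0..19} \<union> {N-19..N})" unfolding inner_def using long_sub by auto
    then have "card long \<le> card (inner \<union> ({0..19} \<union> {N-19..N}))" using fin by (intro card_mono) auto
    also have "\<dots> \<le> card inner + card ({0..19} \<union> {N-19..N})" by (rule card_Un_le)
    finally show ?thesis .
  qed
  moreover have "card ({0..19::int} \<union> {N-19..N}) \<le> 40"
    using card_Un_le[of "{0..19::int}" "{N-19..N}"] by simp
  ultimately show ?thesis by linarith
qed

end

section \<open>The grid\<close>

lemma disjoint_balls_dist: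
  fixes c c' :: "'a::real_normed_vector"
  assumes "ball c r \<inter> ball c' r' = {}" "0 < r" "0 < r'"
  shows "r + r' \<le> dist c c'"
proof (rule ccontr)
  assume less: "\<not> r + r' \<le> dist c c'"
  \<comment> \<open>The point dividing the segment of centres in the ratio \<open>r : r'\<close>
    would lie in both balls.\<close>
  define p where "p = c + (r / (r + r')) *\<^sub>R (c' - c)"
  have scaled: "t / (r + r') * dist c c' < t" if "0 < t" for t
    using less that assms by (simp add: pos_divide_less_eq)
  have "norm (p - c) = r / (r + r') * dist c c'"
    using assms by (simp add: p_def dist_norm norm_minus_commute)
  then have "dist c p < r" using scaled[of r] assms by (simp add: dist_norm norm_minus_commute)
  moreover have "c' - p = (1 - r / (r + r')) *\<^sub>R (c' - c)"
    by (simp add: p_def algebra_simps)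
  then have "c' - p = (r' / (r + r')) *\<^sub>R (c' - c)" using assms by (simp add: field_simps)
  then have "norm (c' - p) = r' / (r + r') * dist c c'"
    using assms by (simp add: dist_norm norm_minus_commute)
  then have "dist c' p < r'" using scaled[of r'] assms by (simp add: dist_norm)
  ultimately have "p \<in> ball c r \<inter> ball c' r'" by simp
  then show False using assms by simp
qed

lemma dist_square_vec2:
  fixes u v :: "real^2"
  shows "(dist u v)\<^sup>2 = (u$1 - v$1)\<^sup>2 + (u$2 - v$2)\<^sup>2"
  by (simp add: dist_norm norm_vec_def L2_set_def sum_2)

text \<open>A disk through \<open>(a1, -b1)\<close> and \<open>(a2, b2)\<close> whose centre is at height \<open>h\<close>: avoiding the integer
  points, it meets the axis in a chord of length at most 1, so it hardly crosses the axis.\<close>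

lemma no_crossing:
  fixes a1 a2 b1 b2 x h r :: real and N :: int
  assumes a: "0 \<le> a1" "a1 \<le> of_int N" "0 \<le> a2" "a2 \<le> of_int N" and b: "1 \<le> b1" "1 \<le> b2"
    and t1: "r\<^sup>2 = (a1 - x)\<^sup>2 + (b1 + h)\<^sup>2" and t2: "r\<^sup>2 = (a2 - x)\<^sup>2 + (b2 - h)\<^sup>2"
    and free: "\<And>k. k \<in> {0..N + 1} \<Longrightarrow> r\<^sup>2 \<le> (of_int k - x)\<^sup>2 + h\<^sup>2"
  shows False
proof -
  \<comment> \<open>The point where the chord between the two touched points crosses the
    axis.\<close>
  define z where "z = (b2 * a1 + b1 * a2) / (b1 + b2)"
  have bpos: "0 < b1 + b2" using b by simp
  have zz: "z * (b1 + b2) = b2 * a1 + b1 * a2" using bpos by (simp add: z_def)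
  have z: "0 \<le> z" "z \<le> of_int N"
  proof -
    show "0 \<le> z" unfolding z_def using a b by simp
    have "b2 * a1 + b1 * a2 \<le> b2 * of_int N + b1 * of_int N" using a b by (intro add_mono mult_left_mono) auto
    then show "z \<le> of_int N" unfolding z_def using bpos by (simp add: divide_le_eq algebra_simps)
  qed
  \<comment> \<open>The power of the point \<open>z\<close>: the product of the two parts into which
    it divides the chord.\<close>
  have "(b1 + b2)\<^sup>2 * (r\<^sup>2 - ((z - x)\<^sup>2 + h\<^sup>2)) = b1 * b2 * ((a1 - a2)\<^sup>2 + (b1 + b2)\<^sup>2)"
  proof -
    have "(b1 + b2)\<^sup>2 * r\<^sup>2 = (b1 + b2) * (b2 * r\<^sup>2 + b1 * r\<^sup>2)" by (simp add: power2_eq_square algebra_simps)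
    also have "\<dots> = (b1 + b2) * (b2 * ((a1 - x)\<^sup>2 + (b1 + h)\<^sup>2) + b1 * ((a2 - x)\<^sup>2 + (b2 - h)\<^sup>2))"
      using t1 t2 by metis
    finally have 1: "(b1 + b2)\<^sup>2 * r\<^sup>2 = \<dots>" .
    have 2: "(b1 + b2)\<^sup>2 * (z - x)\<^sup>2 = (b2 * a1 + b1 * a2 - (b1 + b2) * x)\<^sup>2"
      unfolding zz[symmetric] by (simp add: power2_eq_square algebra_simps)
    show ?thesis unfolding right_diff_distrib distrib_left[of "(b1 + b2)\<^sup>2" "(z - x)\<^sup>2"] 1 2
      by (simp add: power2_eq_square algebra_simps)
  qed
  moreover have "0 < b1 * b2 * ((a1 - a2)\<^sup>2 + (b1 + b2)\<^sup>2)"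
    using b by (intro mult_pos_pos add_nonneg_pos) auto
  ultimately have "0 < (b1 + b2)\<^sup>2 * (r\<^sup>2 - ((z - x)\<^sup>2 + h\<^sup>2))" by metis
  then have inside: "(z - x)\<^sup>2 < r\<^sup>2 - h\<^sup>2"
    using bpos by (simp add: zero_less_mult_iff)
  define k where "k = \<lfloor>z\<rfloor>"
  have k: "of_int k \<le> z" "z < of_int k + 1" "k \<in> {0..N}"
    unfolding k_def using z by (auto simp: floor_le_iff)
  have k0: "r\<^sup>2 - h\<^sup>2 \<le> (of_int k - x)\<^sup>2" and k1: "r\<^sup>2 - h\<^sup>2 \<le> (of_int k + 1 - x)\<^sup>2"
    using free[of k] free[of "k + 1"] k by auto
  \<comment> \<open>Both integers next to \<open>z\<close> are farther from \<open>x\<close> than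
    \<open>z\<close> is, so \<open>x\<close> lies between them and within 1/2 of one. The larger of
    them may be \<open>N + 1\<close>.\<close>
  have "\<bar>z - x\<bar> < \<bar>of_int k - x\<bar>" "\<bar>z - x\<bar> < \<bar>of_int k + 1 - x\<bar>"
    using inside k0 k1 by (auto intro!: power2_less_imp_less[of "\<bar>z - x\<bar>"])
  then have "\<bar>of_int k - x\<bar> \<le> 1/2 \<or> \<bar>of_int k + 1 - x\<bar> \<le> 1/2" using k by linarith
  then have "r\<^sup>2 - h\<^sup>2 \<le> (1/2)\<^sup>2"
    using k0 k1 power2_le_iff_abs_le[of "1/2"] by (meson order_trans zero_le_divide_1_iff zero_le_numeral)
  then have w: "r\<^sup>2 \<le> h\<^sup>2 + 1/4" by (simp add: power_divide)
  have s: "1 \<le> b1\<^sup>2" "1 \<le> b2\<^sup>2" using b by (simp_all add: one_le_power)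
  \<comment> \<open>The touched point across the axis from the centre forces
    \<open>r^2 \<ge> h^2 + 1\<close>, against the bound \<open>h^2 + 1/4\<close>.\<close>
  show False
  proof (cases "0 \<le> h")
    case True
    then have "0 \<le> b1 * h" using b by simp
    then show False using t1 w s zero_le_power2[of "a1 - x"] by (simp add: power2_sum)
  next
    case False
    then have "b2 * h \<le> 0" using b by (simp add: mult_nonneg_nonpos)
    then show False using t2 w s zero_le_power2[of "a2 - x"] by (simp add: power2_diff)
  qed
qed

text \<open>The index \<open>(s, i)\<close> stands for the \<open>i\<close>-th position in row \<open>s\<close>; rows with even \<open>s\<close> are full. Only
  the disks of points in the core are counted; the remaining sites, one at each end of each full
  row, give every core point of a full row two neighbours.\<close>

definition pt :: "int \<times> int \<Rightarrow> real^2" where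
  "pt q = vector [of_int (snd q), 62 * of_int (fst q)]"

definition full_rows :: "int set" where
  "full_rows = {s \<in> {0..100}. even s}"

definition core :: "int \<Rightarrow> (int \<times> int) set" where
  "core N = {(s, i). s \<in> {0..100} \<and> i \<in> {0..N} \<and> (even s \<or> 125 dvd i)}"

definition sparse :: "int \<Rightarrow> (int \<times> int) set" where
  "sparse N = {(s, i) \<in> core N. odd s}"

definition sites :: "int \<Rightarrow> (int \<times> int) set" where
  "sites N = core N \<union> full_rows \<times> {-1, N + 1}"

section \<open>Covering families of the grid\<close>

locale covered_grid =
  fixes N :: int and P :: "(real^2) set" and F :: "(real^2) set set"
  assumes cover: "covering_family P F" and sites: "pt ` sites N \<subseteq> P"
begin

definition center :: "(real^2) set \<Rightarrow> real^2" where
  "center B = (SOME c. \<exists>r>0. B = cball c r)"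

definition radius :: "(real^2) set \<Rightarrow> real" where
  "radius B = (SOME r. r > 0 \<and> B = cball (center B) r)"

text \<open>A point may lie on several disks of the family. Fixing one of them partitions the core
  into fibres, and a disk serves the points of its fibre.\<close>

definition disk_of :: "int \<times> int \<Rightarrow> (real^2) set" where
  "disk_of q = (SOME B. B \<in> F \<and> pt q \<in> frontier B)"

lemma disk:
  assumes "B \<in> F"
  shows "0 < radius B" "B = cball (center B) (radius B)"
proof -
  have "\<exists>c. \<exists>r>0. B = cball c r"
    using assms cover unfolding covering_family_def empty_disk_def is_disk_def by blast
  then have "\<exists>r>0. B = cball (center B) r" unfolding center_def by (rule someI_ex)
  then have "radius B > 0 \<and> B = cball (center B) (radius B)" unfolding radius_def by (rule someI_ex)
  then show "0 < radius B" "B = cball (center B) (radius B)" by auto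
qed

lemma interior_disk: "B \<in> F \<Longrightarrow> interior B = ball (center B) (radius B)"
  using disk(2)[of B] interior_cball by metis

lemma core_sites: "core N \<subseteq> sites N"
  unfolding sites_def by auto

lemma disk_of:
  assumes "q \<in> core N"
  shows "disk_of q \<in> F" "pt q \<in> frontier (disk_of q)"
proof -
  have "pt q \<in> P" using assms sites core_sites by auto
  then have "\<exists>B. B \<in> F \<and> pt q \<in> frontier B" using cover unfolding covering_family_def by blast
  then have "disk_of q \<in> F \<and> pt q \<in> frontier (disk_of q)" unfolding disk_of_def by (rule someI_ex)
  then show "disk_of q \<in> F" "pt q \<in> frontier (disk_of q)" by auto
qed

lemma dist_center:
  assumes "q \<in> core N"
  shows "dist (pt q) (center (disk_of q)) = radius (disk_of q)"
proof -
  have "frontier (disk_of q) = sphere (center (disk_of q)) (radius (disk_of q))"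
    using disk[OF disk_of(1)[OF assms]] by (metis frontier_cball)
  then show ?thesis using disk_of(2)[OF assms] by (simp add: dist_commute)
qed

lemma touch:
  assumes "(s, i) \<in> core N"
  shows "(radius (disk_of (s, i)))\<^sup>2 =
    (of_int i - center (disk_of (s, i)) $ 1)\<^sup>2 + (center (disk_of (s, i)) $ 2 - 62 * of_int s)\<^sup>2"
  using dist_square_vec2[of "pt (s, i)" "center (disk_of (s, i))"] dist_center[OF assms]
  by (simp add: pt_def power2_commute)

lemma empty:
  assumes "B \<in> F" "(s, k) \<in> sites N"
  shows "(radius B)\<^sup>2 \<le> (of_int k - center B $ 1)\<^sup>2 + (center B $ 2 - 62 * of_int s)\<^sup>2"
proof -
  have "pt (s, k) \<notin> ball (center B) (radius B)"
    using assms sites cover interior_disk[OF assms(1)] unfolding covering_family_def empty_disk_def by blast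
  then have "radius B \<le> dist (pt (s, k)) (center B)" by (simp add: dist_commute)
  then have "(radius B)\<^sup>2 \<le> (dist (pt (s, k)) (center B))\<^sup>2"
    using disk(1)[OF assms(1)] by (intro power_mono) auto
  then show ?thesis by (simp add: dist_square_vec2 pt_def power2_commute)
qed

lemma disjoint:
  assumes "A \<in> F" "B \<in> F" "A \<noteq> B"
  shows "(radius A + radius B)\<^sup>2 \<le> (center A $ 1 - center B $ 1)\<^sup>2 + (center A $ 2 - center B $ 2)\<^sup>2"
proof -
  have "ball (center A) (radius A) \<inter> ball (center B) (radius B) = {}"
    using assms cover interior_disk unfolding covering_family_def pairwise_disjoint_disks_def pairwise_def
    by metis
  then have "radius A + radius B \<le> dist (center A) (center B)"
    using disjoint_balls_dist disk(1) assms by blast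
  then have "(radius A + radius B)\<^sup>2 \<le> (dist (center A) (center B))\<^sup>2"
    using disk(1)[OF assms(1)] disk(1)[OF assms(2)] by (intro power_mono) auto
  then show ?thesis by (simp add: dist_square_vec2)
qed

definition long :: "int \<Rightarrow> int set" where
  "long s = {i \<in> {0..N}. \<exists>(s', i') \<in> core N. disk_of (s', i') = disk_of (s, i) \<and> s' \<noteq> s}"

lemma long_radius:
  assumes "s \<in> full_rows" "i \<in> long s"
  shows "31 \<le> radius (disk_of (s, i))"
proof -
  have q: "(s, i) \<in> core N" using assms unfolding full_rows_def long_def core_def by auto
  obtain s' i' where q': "(s', i') \<in> core N" "disk_of (s', i') = disk_of (s, i)" "s' \<noteq> s"
    using assms unfolding long_def by auto
  have "\<bar>s - s'\<bar> \<ge> 1" using q' by auto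
  then have "\<bar>real_of_int s - of_int s'\<bar> \<ge> 1" by linarith
  then have "62 \<le> \<bar>pt (s, i) $ 2 - pt (s', i') $ 2\<bar>" unfolding pt_def by simp
  also have "\<dots> \<le> dist (pt (s, i)) (pt (s', i'))"
    using component_le_norm_cart[of "pt (s, i) - pt (s', i')" 2] by (simp add: dist_norm)
  also have "\<dots> \<le> 2 * radius (disk_of (s, i))"
    using dist_center[OF q] dist_center[OF q'(1)] dist_triangle2[of "pt (s, i)" "pt (s', i')"] q'(2)
    by (metis mult_2)
  finally show ?thesis by simp
qed

lemma row:
  assumes "s \<in> full_rows"
  shows "row N (\<lambda>i. disk_of (s, i)) (\<lambda>B. center B $ 1) (\<lambda>B. center B $ 2 - 62 * of_int s) radius (long s)"
proof
  have q: "(s, i) \<in> core N" if "i \<in> {0..N}" for i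
    using that assms unfolding core_def full_rows_def by auto
  have p: "(s, i) \<in> sites N" if "i \<in> {-1..N+1}" for i
    using that assms unfolding sites_def core_def full_rows_def by force
  fix i k
  show "0 < radius (disk_of (s, i))" if "i \<in> {0..N}" using disk(1) disk_of(1) q that by blast
  show "(radius (disk_of (s, i)))\<^sup>2 =
    (of_int i - center (disk_of (s, i)) $ 1)\<^sup>2 + (center (disk_of (s, i)) $ 2 - 62 * of_int s)\<^sup>2"
    if "i \<in> {0..N}" using touch q that by blast
  show "(radius (disk_of (s, i)))\<^sup>2 \<le>
    (of_int k - center (disk_of (s, i)) $ 1)\<^sup>2 + (center (disk_of (s, i)) $ 2 - 62 * of_int s)\<^sup>2"
    if "i \<in> {0..N}" "k \<in> {-1..N+1}" using empty disk_of(1) p q that by blast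
  show "(radius (disk_of (s, i)) + radius (disk_of (s, k)))\<^sup>2 \<le>
    (center (disk_of (s, i)) $ 1 - center (disk_of (s, k)) $ 1)\<^sup>2 +
    (center (disk_of (s, i)) $ 2 - 62 * of_int s - (center (disk_of (s, k)) $ 2 - 62 * of_int s))\<^sup>2"
    if "i \<in> {0..N}" "k \<in> {0..N}" "disk_of (s, i) \<noteq> disk_of (s, k)"
    using disjoint disk_of(1) q that by simp
  show "long s \<subseteq> {0..N}" unfolding long_def by auto
  show "31 \<le> radius (disk_of (s, i))" if "i \<in> long s" using long_radius assms that by blast
  show "k \<in> long s" if "i \<in> long s" "k \<in> {0..N}" "disk_of (s, k) = disk_of (s, i)"
    using that unfolding long_def by auto
qed

text \<open>The chord would have length at least 125. Consider the full row at distance 62 on the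
  side of the centre and its point within 1/2 of the chord's perpendicular bisector: it would be
  inside, because 62^2 + 1/4 < (125/2)^2.\<close>

lemma sparse_row_disk:
  assumes q: "(s, i) \<in> sparse N" "(s, j) \<in> sparse N" and eq: "disk_of (s, i) = disk_of (s, j)"
  shows "i = j"
proof (rule ccontr)
  assume "i \<noteq> j"
  let ?B = "disk_of (s, i)"
  define u where "u = center ?B $ 2 - 62 * of_int s"
  define x where "x = center ?B $ 1"
  have qc: "(s, i) \<in> core N" "(s, j) \<in> core N" using q unfolding sparse_def by auto
  have ij: "125 dvd i" "125 dvd j" "i \<in> {0..N}" "j \<in> {0..N}" "odd s" "s \<in> {0..100}"
    using q unfolding sparse_def core_def by auto
  have ti: "(radius ?B)\<^sup>2 = (of_int i - x)\<^sup>2 + u\<^sup>2" and tj: "(radius ?B)\<^sup>2 = (of_int j - x)\<^sup>2 + u\<^sup>2"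
    using touch[OF qc(1)] touch[OF qc(2)] eq unfolding u_def x_def by auto
  then have "(of_int i - x)\<^sup>2 = (of_int j - x)\<^sup>2" by simp
  then have "of_int i - x = of_int j - x \<or> of_int i - x = - (of_int j - x)" by (rule power2_eq_iff[THEN iffD1])
  then have x: "x = (of_int i + of_int j) / 2" using \<open>i \<noteq> j\<close> by auto
  have "125 dvd i - j" using ij by (intro dvd_diff)
  then have "125 \<le> \<bar>i - j\<bar>" using \<open>i \<noteq> j\<close> zdvd_imp_le[of 125 "\<bar>i - j\<bar>"] by auto
  then have "125 \<le> \<bar>real_of_int i - of_int j\<bar>" by linarith
  then have "125/2 \<le> \<bar>of_int i - x\<bar>" unfolding x by (simp add: field_simps abs_if split: if_splits)
  then have far: "(125/2)\<^sup>2 \<le> (of_int i - x)\<^sup>2" by (simp add: abs_le_square_iff[symmetric])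
  define \<sigma> :: int where "\<sigma> = (if 0 \<le> u then 1 else -1)"
  have \<sigma>: "of_int \<sigma> * u = \<bar>u\<bar>" "\<sigma>\<^sup>2 = 1" "\<sigma> = 1 \<or> \<sigma> = -1" unfolding \<sigma>_def by auto
  define k where "k = (i + j) div 2"
  have k: "k \<in> {0..N}" using ij unfolding k_def by auto
  have "2 * k = i + j \<or> 2 * k + 1 = i + j" unfolding k_def by presburger
  then have "2 * real_of_int k = of_int i + of_int j \<or> 2 * real_of_int k + 1 = of_int i + of_int j"
    by (metis of_int_1 of_int_add of_int_mult of_int_numeral)
  then have "of_int k - x = 0 \<or> of_int k - x = -1/2" unfolding x by (auto simp: field_simps)
  then have "\<bar>of_int k - x\<bar> \<le> 1/2" by auto
  then have near: "(of_int k - x)\<^sup>2 \<le> (1/2)\<^sup>2" by (simp only: power2_le_iff_abs_le)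
  have "s + \<sigma> \<in> full_rows"
    using ij \<sigma>(3) unfolding full_rows_def by (auto elim!: oddE)
  then have "(s + \<sigma>, k) \<in> sites N" using k unfolding sites_def core_def full_rows_def by auto
  from empty[OF disk_of(1)[OF qc(1)] this]
  have "(radius ?B)\<^sup>2 \<le> (of_int k - x)\<^sup>2 + (u - 62 * of_int \<sigma>)\<^sup>2"
    unfolding u_def x_def by (simp add: algebra_simps)
  also have "(u - 62 * of_int \<sigma>)\<^sup>2 = u\<^sup>2 - 124 * (of_int \<sigma> * u) + 62\<^sup>2 * (of_int (\<sigma>\<^sup>2))"
    by (simp add: power2_eq_square algebra_simps)
  also have "\<dots> = u\<^sup>2 - 124 * \<bar>u\<bar> + 62\<^sup>2" unfolding \<sigma> by simp
  finally show False using ti near far by (simp add: power_divide)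
qed

text \<open>For points of different rows, take the full row \<open>s + 1\<close> just above the
  lower one as axis: \<open>no_crossing\<close> forbids a disk touching points at least 62 away on
  both sides.\<close>

lemma sparse_disk:
  assumes q: "p \<in> sparse N" "q \<in> sparse N" and eq: "disk_of p = disk_of q"
  shows "p = q"
proof -
  have less: False if q: "(s, i) \<in> sparse N" "(t, j) \<in> sparse N" and eq: "disk_of (s, i) = disk_of (t, j)" and "s < t" for s i t j
  proof -
    let ?B = "disk_of (s, i)"
    have qc: "(s, i) \<in> core N" "(t, j) \<in> core N" using q unfolding sparse_def by auto
    have ij: "i \<in> {0..N}" "j \<in> {0..N}" "odd s" "odd t" "s \<in> {0..100}" "t \<in> {0..100}"
      using q unfolding sparse_def core_def by auto
    have st: "s + 2 \<le> t" using ij \<open>s < t\<close> by presburger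
    have row: "s + 1 \<in> full_rows" using ij \<open>s < t\<close> unfolding full_rows_def by auto
    show False
    proof (rule no_crossing[of "of_int i" N "of_int j" 62 "62 * (of_int t - of_int s - 1)"])
      show "(radius ?B)\<^sup>2 = (of_int i - center ?B $ 1)\<^sup>2 + (62 + (center ?B $ 2 - 62 * (of_int s + 1)))\<^sup>2"
        using touch[OF qc(1)] by (simp add: algebra_simps)
      show "(radius ?B)\<^sup>2 = (of_int j - center ?B $ 1)\<^sup>2 +
          (62 * (of_int t - of_int s - 1) - (center ?B $ 2 - 62 * (of_int s + 1)))\<^sup>2"
        using touch[OF qc(2)] eq by (subst power2_commute) (simp add: algebra_simps)
      show "(radius ?B)\<^sup>2 \<le> (of_int k - center ?B $ 1)\<^sup>2 + (center ?B $ 2 - 62 * (of_int s + 1))\<^sup>2"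
        if "k \<in> {0..N + 1}" for k
      proof -
        have "(s + 1, k) \<in> sites N" using row that unfolding sites_def core_def full_rows_def by auto
        then show ?thesis using empty[OF disk_of(1)[OF qc(1)]] by force
      qed
    qed (use ij st in auto)
  qed
  obtain s i t j where "p = (s, i)" "q = (t, j)" by (cases p, cases q)
  then show ?thesis using less[of s i t j] less[of t j s i] sparse_row_disk[of s i j] assms
    by (metis linorder_less_linear)
qed

section \<open>Double counting over the disks\<close>

definition long_points :: "(int \<times> int) set" where
  "long_points = Sigma full_rows long"

definition single_points :: "(int \<times> int) set" where
  "single_points = Sigma full_rows (\<lambda>s. row.single N (\<lambda>i. disk_of (s, i)) (long s))"

lemma finite_core: "finite (core N)"
  by (rule finite_subset[of _ "{0..100} \<times> {0..N}"]) (auto simp: core_def)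

lemma single_points_iff:
  "(s, i) \<in> single_points \<longleftrightarrow> s \<in> full_rows \<and> i \<in> {0..N} \<and> i \<notin> long s \<and>
     (\<forall>k\<in>{0..N}. disk_of (s, k) = disk_of (s, i) \<longrightarrow> k = i)"
  unfolding single_points_def by (auto simp: row.single_def[OF row])

lemma core_cases: "q \<in> core N \<Longrightarrow> q \<in> sparse N \<or> fst q \<in> full_rows"
  unfolding core_def sparse_def full_rows_def by auto

lemma subsets_core: "sparse N \<subseteq> core N" "long_points \<subseteq> core N" "single_points \<subseteq> core N"
  unfolding sparse_def long_points_def long_def core_def full_rows_def
  by (auto simp: single_points_iff full_rows_def)

lemma long_points_le: "card long_points \<le> card single_points + 40 * card full_rows"
proof -
  have fin: "finite full_rows" by (rule finite_subset[of _ "{0..100}"]) (auto simp: full_rows_def)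
  have fl: "finite (long s)" for s by (rule finite_subset[of _ "{0..N}"]) (auto simp: long_def)
  have fs: "finite (row.single N (\<lambda>i. disk_of (s, i)) (long s))" if "s \<in> full_rows" for s
    using row.finite_single[OF row[OF that]] .
  have "card long_points = (\<Sum>s\<in>full_rows. card (long s))"
    unfolding long_points_def using fin fl by (simp add: card_SigmaI)
  also have "\<dots> \<le> (\<Sum>s\<in>full_rows. card (row.single N (\<lambda>i. disk_of (s, i)) (long s)) + 40)"
    using row.long_le_single[OF row] by (intro sum_mono)
  also have "\<dots> = card single_points + 40 * card full_rows"
    unfolding single_points_def using fin fs by (simp add: card_SigmaI sum.distrib)
  finally show ?thesis .
qed

text \<open>The local account of one disk: sparse and lonely points are charged an extra unit, long
  points are credited one, and two units per disk suffice. Summed over all disks, the lonely points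
  cancel the long ones.\<close>

lemma disk_waste:
  fixes B
  defines "C \<equiv> \<lambda>T. {q \<in> T. disk_of q = B}"
  shows "card (C (core N)) + card (C (sparse N)) + card (C single_points) \<le> 2 + card (C long_points)"
proof -
  have fin: "finite (C T)" if "T \<subseteq> core N" for T
    using finite_core that unfolding C_def by (auto intro: finite_subset)
  have one: "card (C (sparse N)) \<le> 1"
    using sparse_disk fin[OF subsets_core(1)] unfolding C_def by (subst card_le_Suc0_iff_eq[folded One_nat_def]) auto
  show ?thesis
  \<comment> \<open>If only sparse and long points are served, the single possible sparse point
    costs its two units. Otherwise the disk serves a full-row point that is not long, hence at most
    two points, all in that row; a lonely one is then alone and costs two units.\<close>
  proof (cases "C (core N) \<subseteq> C (sparse N) \<union> C long_points")
    case True
    have "C single_points = {}"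
    proof -
      have "single_points \<inter> (sparse N \<union> long_points) = {}"
        unfolding long_points_def sparse_def by (auto simp: single_points_iff full_rows_def)
      then show ?thesis using True subsets_core(3) unfolding C_def by blast
    qed
    moreover have "card (C (core N)) \<le> card (C (sparse N)) + card (C long_points)"
      using card_mono[OF _ True] fin subsets_core card_Un_le[of "C (sparse N)" "C long_points"] by (meson finite_UnI order_trans)
    ultimately show ?thesis using one by simp
  next
    case False
    then obtain s i where si: "(s, i) \<in> core N" "disk_of (s, i) = B" "s \<in> full_rows" "i \<notin> long s"
      using core_cases unfolding C_def long_points_def by force
    interpret row N "\<lambda>i. disk_of (s, i)" "\<lambda>B. center B $ 1" "\<lambda>B. center B $ 2 - 62 * of_int s" radius "long s"
      using row[OF si(3)] .
    have iN: "i \<in> {0..N}" using si unfolding core_def by auto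
    have in_row: "t = s" if "(t, j) \<in> C (core N)" for t j
      using that si iN unfolding C_def long_def by auto
    have "C (sparse N) = {}"
      using in_row si(3) unfolding C_def sparse_def full_rows_def by auto
    moreover have sub: "C (core N) \<subseteq> Pair s ` {j\<in>{0..N}. disk_of (s, j) = B}"
      using in_row unfolding C_def core_def by auto
    have "card (C (core N)) \<le> 2"
    proof -
      have "card (C (core N)) \<le> card (Pair s ` {j\<in>{0..N}. disk_of (s, j) = B})"
        using sub by (intro card_mono finite_imageI finite_class)
      also have "\<dots> \<le> card {j\<in>{0..N}. disk_of (s, j) = B}" by (rule card_image_le[OF finite_class])
      finally show ?thesis using class_card[of B] by simp
    qed
    moreover have "card (C (core N)) = 1 \<and> card (C single_points) \<le> 1" if ne: "C single_points \<noteq> {}"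
    proof -
      obtain t j where tj: "(t, j) \<in> C single_points" using ne by fast
      then have "t = s" using in_row subsets_core(3) unfolding C_def by auto
      then have alone: "b = j" if "b \<in> {0..N}" "disk_of (s, b) = B" for b
        using tj that unfolding C_def by (simp add: single_points_iff)
      have "q = (s, j)" if q: "q \<in> C (core N)" for q
      proof -
        obtain a b where ab: "q = (a, b)" by (cases q)
        then have "a = s" using in_row q by simp
        then show ?thesis using alone[of b] q ab unfolding C_def core_def by simp
      qed
      then have "C (core N) \<subseteq> {(s, j)}" by blast
      moreover have "C single_points \<subseteq> C (core N)" using subsets_core(3) unfolding C_def by auto
      ultimately have "C (core N) = {(s, j)}" "C single_points \<subseteq> {(s, j)}" using ne by auto
      then show ?thesis using card_mono[of "{(s, j)}"] by auto
    qed
    ultimately show ?thesis by (cases "C single_points = {}") auto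
  qed
qed

lemma card_fibres:
  assumes "T \<subseteq> core N"
  shows "card T = (\<Sum>B\<in>disk_of ` core N. card {q \<in> T. disk_of q = B})"
  using sum.group[OF finite_subset[OF assms finite_core] finite_imageI[OF finite_core] image_mono[OF assms, of disk_of],
      of "\<lambda>_. 1::nat"] by simp

theorem grid_bound: "card (core N) + card (sparse N) \<le> 2 * card F + 40 * card full_rows"
proof -
  have "card (core N) + card (sparse N) + card single_points \<le> (\<Sum>B\<in>disk_of ` core N. 2) + card long_points"
    unfolding card_fibres[OF order_refl] card_fibres[OF subsets_core(1)] card_fibres[OF subsets_core(2)]
      card_fibres[OF subsets_core(3)] sum.distrib[symmetric]
    by (rule sum_mono[OF disk_waste])
  moreover have "card (disk_of ` core N) \<le> card F"
    using disk_of(1) cover unfolding covering_family_def by (intro card_mono) auto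
  ultimately show ?thesis using long_points_le by simp
qed

end

section \<open>Cardinalities and the final estimate\<close>

lemma full_rows_eq: "full_rows = (\<lambda>t. 2 * t) ` {0..50}"
  unfolding full_rows_def by (auto elim!: evenE)

lemma card_full_rows: "card full_rows = 51"
  unfolding full_rows_eq by (subst card_image) (auto simp: inj_on_def)

lemma sparse_eq: "sparse (125 * int l) = (\<lambda>(t, m). (2 * t + 1, 125 * m)) ` ({0..49} \<times> {0..int l})"
proof -
  have "(s, i) \<in> (\<lambda>(t, m). (2 * t + 1, 125 * m)) ` ({0..49} \<times> {0..int l})"
    if si: "s \<in> {0..100}" "odd s" "i \<in> {0..125 * int l}" "125 dvd i" for s i :: int
  proof -
    obtain t m where "s = 2 * t + 1" "i = 125 * m" using si(2,4) by (metis oddE dvdE)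
    then show ?thesis using si by (intro image_eqI[of _ _ "(t, m)"]) auto
  qed
  then show ?thesis unfolding sparse_def core_def by auto
qed

lemma card_sparse: "card (sparse (125 * int l)) = 50 * (l + 1)"
  unfolding sparse_eq by (subst card_image) (auto simp: inj_on_def card_cartesian_product)

lemma card_core: "card (core (125 * int l)) = 51 * (125 * l + 1) + 50 * (l + 1)"
proof -
  have "core (125 * int l) = full_rows \<times> {0..125 * int l} \<union> sparse (125 * int l)"
    unfolding core_def sparse_def full_rows_def by auto
  moreover have "card (full_rows \<times> {0..125 * int l} \<union> sparse (125 * int l)) =
      card (full_rows \<times> {0..125 * int l}) + card (sparse (125 * int l))"
  proof (rule card_Un_disjoint)
    show "finite (full_rows \<times> {0..125 * int l})" unfolding full_rows_eq by auto
    show "finite (sparse (125 * int l))" unfolding sparse_eq by auto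
    show "full_rows \<times> {0..125 * int l} \<inter> sparse (125 * int l) = {}"
      unfolding sparse_def full_rows_def by auto
  qed
  ultimately show ?thesis
    by (simp add: card_cartesian_product card_full_rows card_sparse nat_add_distrib nat_mult_distrib)
qed

lemma card_sites: "finite (sites (125 * int l))" "card (sites (125 * int l)) \<le> 6425 * l + 203"
proof -
  have fin: "finite (core (125 * int l))" using card_core[of l] by (intro card_ge_0_finite) simp
  then show "finite (sites (125 * int l))" unfolding sites_def full_rows_eq by auto
  have "card (sites (125 * int l)) \<le> card (core (125 * int l)) + card (full_rows \<times> {-1, 125 * int l + 1})"
    unfolding sites_def by (rule card_Un_le)
  then show "card (sites (125 * int l)) \<le> 6425 * l + 203"
    by (simp add: card_core card_cartesian_product card_full_rows)
qed

text \<open>The sites are padded with arbitrary further points to exactly \<open>n\<close> points;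
  \<open>covered_grid\<close> only asks that the sites be contained in \<open>P\<close>. Core and
  sparse points together count \<open>6475 * l + 151\<close>, and 1889 = 40 * 51 - 151.\<close>

lemma D_lower_bound:
  assumes "6425 * l + 203 \<le> n"
  shows "6475 * l \<le> 2 * D n + 1889"
proof -
  have "infinite (UNIV :: (real^2) set)" using finite_imp_bounded not_bounded_UNIV by blast
  then have "infinite (- pt ` sites (125 * int l))"
    using card_sites(1) by (simp add: Compl_eq_Diff_UNIV)
  then obtain T where T: "T \<subseteq> - pt ` sites (125 * int l)" "finite T" "card T = n - card (pt ` sites (125 * int l))"
    using infinite_arbitrarily_large by metis
  define P where "P = pt ` sites (125 * int l) \<union> T"
  have "card (pt ` sites (125 * int l)) \<le> n"
    using card_image_le[OF card_sites(1)] card_sites(2) assms by (meson order_trans)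
  then have P: "finite P" "card P = n"
    using T card_sites(1) unfolding P_def by (auto simp: card_Un_disjoint disjoint_eq_subset_Compl Int_commute)
  obtain F where F: "covering_family P F" "card F = D_set P" using D_set_attained[OF P(1)] by blast
  interpret covered_grid "125 * int l" P F
    by unfold_locales (use F P_def in auto)
  have "D_set P \<le> D n" unfolding D_def using P by (intro Max_ge D_range_finite) auto
  then show ?thesis using grid_bound F by (simp add: card_core card_sparse card_full_rows)
qed

theorem theorem3:
  "\<exists>C::real. \<forall>n::nat. n \<ge> 1 \<longrightarrow> real (D n) \<ge> (1/2 + 1/257) * real n - C"
proof (intro exI allI impI)
  fix n :: nat
  \<comment> \<open>The slope is 6475 / (2 * 6425) = 259/514 = 1/2 + 1/257. The constant 5000
    absorbs 1889/2 and the slope times 6628, where 6628 = 6425 + 203 comes from rounding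
    \<open>n\<close> down to a grid size.\<close>
  show "real (D n) \<ge> (1/2 + 1/257) * real n - 5000"
  proof (cases "n < 203")
    case True
    then show ?thesis by simp
  next
    case False
    define l where "l = (n - 203) div 6425"
    have "6425 * l + 203 \<le> n" "n < 6425 * l + 6628"
      using False div_mult_mod_eq[of "n - 203" 6425] mod_less_divisor[of 6425 "n - 203"]
      unfolding l_def by linarith+
    then have "6475 * l \<le> 2 * D n + 1889" "n < 6425 * l + 6628" using D_lower_bound by auto
    then have "6475 * real l \<le> 2 * real (D n) + 1889" "real n < 6425 * real l + 6628" by linarith+
    then show ?thesis by simp
  qed
qed

end
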